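(* Assume $\operatorname{char} k=0$. Let $H(z)\in k\langle\langle z\rangle\rangle^{\times n}$ with $o(H(z))\ge2$, let $F_t(z)=z-tH(z)$, write the inverse map of $F_t(z)$ as $G_t(z)=z+tN_t(z)$ with $N_t(z)\in k[[t]]\langle\langle z\rangle\rangle^{\times n}$, and write $N_t(z)=\sum_{m\ge1}t^{m-1}N_{[m]}(z)$ with $N_{[m]}(z)\in k\langle\langle z\rangle\rangle^{\times n}$. Then for any $m\ge1$, $$N_{[m]}(z)=\sum_{T\in\mathbb{B}^{\mathcal P}_{2m-1}}\frac1{\widehat T!}N_T(z)=\sum_{\substack{T\in\mathbb{B}^{\mathcal P}\\ l(T)=m}}\frac1{\widehat T!}N_T(z).$$ Therefore $$N_t(z)=\sum_{T\in\mathbb{B}^{\mathcal P}\setminus\{\emptyset\}}\frac{t^{\,l(T)-1}}{\widehat T!}N_T(z),\qquad G_t(z)=\sum_{T\in\mathbb{B}^{\mathcal P}}\frac{t^{\,l(T)}}{\widehat T!}N_T(z).$$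
   Context: Algebra. $k$ is a (commutative) unital integral domain; $n\ge1$; $z=(z_1,\dots,z_n)$ are noncommutative free variables; $t$ is a formal parameter commuting with $z$. $k\langle\langle z\rangle\rangle$ and $k[[t]]\langle\langle z\rangle\rangle$ are the algebras of formal power series in the noncommuting $z_i$ over $k$ and $k[[t]]$. The order $o(U)$ of a vector $U$ is the minimum of the orders (lowest degree in $z$) of its components. The inverse map $G_t$ of $F_t$ is the vector with $F_t(G_t(z))=z=G_t(F_t(z))$ (substitution of components for the $z_i$); it exists and is of the form $z+tN_t(z)$ with $o(N_t(z))\ge2$. For $\vec u\in k\langle\langle z\rangle\rangle^{\times n}$, $[\vec u\frac{\partial}{\partial z}]$ is the unique $k$-derivation of $k\langle\langle z\rangle\rangle$ sending $z_i$ to $u_i$ for all $i$, acting componentwise on vectors. Division by integers is read over the fraction field of $k$. Trees. A rooted tree is a finite tree with a designated root; a leaf is a vertex without children. It is binary if every non-leaf vertex has exactly two children, and planar if the children of each non-leaf vertex are given a fixed linear order. The empty set $\emptyset$ is also counted as a (planar binary) rooted tree, and $\circ$ is the one-vertex tree. $\mathbb{B}^{\mathcal P}$ is the set of (isomorphism classes of) planar binary rooted trees (including $\emptyset$), and $\mathbb{B}^{\mathcal P}_m$ those with $m$ vertices. $|T|$ is the number of vertices and $l(T)$ the number of leaves of $T$ (so $l(\emptyset)=0$). $\widehat T$ is the rooted tree obtained from $T$ by deleting all its leaves (so $\widehat\circ=\widehat\emptyset=\emptyset$). $B_+(T_1,\dots,T_d)$ is the rooted tree obtained by connecting the roots of the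 nonempty trees $T_1,\dots,T_d$ to a new vertex, which becomes the root; for planar trees the children of the new root are ordered as $T_1,\dots,T_d$. The tree factorial is defined by $\emptyset!=1$, $\circ!=1$, and $T!=|T|\,T_1!\cdots T_d!$ for $T=B_+(T_1,\dots,T_d)$. For $T\in\mathbb{B}^{\mathcal P}$ define $N_T(z)\in k\langle\langle z\rangle\rangle^{\times n}$ by $N_\emptyset(z)=z$, $N_\circ(z)=H(z)$, and $N_T(z)=\left[N_{T_1}(z)\frac{\partial}{\partial z}\right]N_{T_2}(z)$ for $T=B_+(T_1,T_2)$. *)

theory Defs
  imports
    "HOL-Computational_Algebra.Formal_Power_Series"
    "HOL-Computational_Algebra.Polynomial_Factorial"
    "HOL-Library.Extended_Nat"
    "HOL-Analysis.Infinite_Sum"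
begin

section \<open>Formal power series in noncommuting variables\<close>

text \<open>The variables \<open>z\<^sub>i\<close> are indexed by a type \<open>'n\<close>, later assumed finite; monomials are words,
  that is, lists over \<open>'n\<close>.\<close>

typedef ('n, 'a) ncps = "UNIV :: ('n list \<Rightarrow> 'a) set"
  morphisms ncoeff Abs_ncps ..

lemma ncoeff_Abs_ncps [simp]: "ncoeff (Abs_ncps f) w = f w"
  by (simp add: Abs_ncps_inverse)

lemma ncps_eqI: "(\<And>w. ncoeff f w = ncoeff g w) \<Longrightarrow> f = g"
  by (metis ext ncoeff_inject)

instantiation ncps :: (type, ring_1) ring_1
begin

definition zero_ncps :: "('a, 'b) ncps" where
  "zero_ncps = Abs_ncps (\<lambda>w. 0)"

definition one_ncps :: "('a, 'b) ncps" where
  "one_ncps = Abs_ncps (\<lambda>w. if w = [] then 1 else 0)"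

definition plus_ncps :: "('a, 'b) ncps \<Rightarrow> ('a, 'b) ncps \<Rightarrow> ('a, 'b) ncps" where
  "plus_ncps f g = Abs_ncps (\<lambda>w. ncoeff f w + ncoeff g w)"

definition minus_ncps :: "('a, 'b) ncps \<Rightarrow> ('a, 'b) ncps \<Rightarrow> ('a, 'b) ncps" where
  "minus_ncps f g = Abs_ncps (\<lambda>w. ncoeff f w - ncoeff g w)"

definition uminus_ncps :: "('a, 'b) ncps \<Rightarrow> ('a, 'b) ncps" where
  "uminus_ncps f = Abs_ncps (\<lambda>w. - ncoeff f w)"

definition times_ncps :: "('a, 'b) ncps \<Rightarrow> ('a, 'b) ncps \<Rightarrow> ('a, 'b) ncps" where
  "times_ncps f g = Abs_ncps (\<lambda>w. \<Sum>i=0..length w. ncoeff f (take i w) * ncoeff g (drop i w))"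

instance
proof
  fix a b c :: "('a, 'b) ncps"
  show "a + b + c = a + (b + c)"
    by (rule ncps_eqI) (simp add: plus_ncps_def add.assoc)
  show "a + b = b + a"
    by (rule ncps_eqI) (simp add: plus_ncps_def add.commute)
  show "0 + a = a"
    by (rule ncps_eqI) (simp add: plus_ncps_def zero_ncps_def)
  show "- a + a = 0"
    by (rule ncps_eqI) (simp add: plus_ncps_def zero_ncps_def uminus_ncps_def)
  show "a - b = a + - b"
    by (rule ncps_eqI) (simp add: plus_ncps_def minus_ncps_def uminus_ncps_def)
  show "(a + b) * c = a * c + b * c"
    by (rule ncps_eqI) (simp add: plus_ncps_def times_ncps_def distrib_right sum.distrib)
  show "a * (b + c) = a * b + a * c"
    by (rule ncps_eqI) (simp add: plus_ncps_def times_ncps_def distrib_left sum.distrib)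
  show "(0::('a, 'b) ncps) \<noteq> 1"
  proof
    assume "(0::('a, 'b) ncps) = 1"
    then have "ncoeff (0::('a, 'b) ncps) [] = ncoeff 1 []" by simp
    then show False by (simp add: zero_ncps_def one_ncps_def)
  qed
  show "1 * a = a"
  proof (rule ncps_eqI)
    fix w
    have "ncoeff (1 * a) w = (\<Sum>i=0..length w. if i = 0 then ncoeff a w else 0)"
      unfolding times_ncps_def ncoeff_Abs_ncps
      by (rule sum.cong) (auto simp: one_ncps_def)
    then show "ncoeff (1 * a) w = ncoeff a w" by simp
  qed
  show "a * 1 = a"
  proof (rule ncps_eqI)
    fix w
    have "ncoeff (a * 1) w = (\<Sum>i=0..length w. if i = length w then ncoeff a w else 0)"
      unfolding times_ncps_def ncoeff_Abs_ncps
      by (rule sum.cong) (auto simp: one_ncps_def)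
    then show "ncoeff (a * 1) w = ncoeff a w" by simp
  qed
  show "a * b * c = a * (b * c)"
  proof (rule ncps_eqI)
    fix w
    define F where "F = (\<lambda>p q (r::nat).
      ncoeff a (take p w) * ncoeff b (take q (drop p w)) * ncoeff c (drop (p + q) w))"
    have "ncoeff (a * b * c) w = (\<Sum>j=0..length w. \<Sum>i=0..j. F i (j - i) (length w - j))"
      by (auto simp: times_ncps_def F_def sum_distrib_right min_def drop_take intro!: sum.cong split: if_splits)
    also have "\<dots> = (\<Sum>j=0..length w. \<Sum>i=0..length w - j. F j i (length w - j - i))"
      by (rule fps_mult_assoc_lemma)
    also have "\<dots> = ncoeff (a * (b * c)) w"
      by (auto simp: times_ncps_def F_def sum_distrib_left mult.assoc add.commute intro!: sum.cong)
    finally show "ncoeff (a * b * c) w = ncoeff (a * (b * c)) w" .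
  qed
qed

end

definition nc_var :: "'n \<Rightarrow> ('n, 'a::ring_1) ncps" where
  "nc_var i = Abs_ncps (\<lambda>w. if w = [i] then 1 else 0)"

definition nc_smult :: "'a::ring_1 \<Rightarrow> ('n, 'a) ncps \<Rightarrow> ('n, 'a) ncps" where
  "nc_smult c f = Abs_ncps (\<lambda>w. c * ncoeff f w)"

text \<open>Change of coefficients along a map; used for the embeddings of \<open>k\<close> into \<open>k[[t]]\<close>, and of
  \<open>k\<close> and \<open>k[[t]]\<close> into \<open>K\<close> and \<open>K[[t]]\<close>, with \<open>K\<close> the fraction field of \<open>k\<close>.\<close>

definition nc_map :: "('a \<Rightarrow> 'b) \<Rightarrow> ('n, 'a) ncps \<Rightarrow> ('n, 'b) ncps" where
  "nc_map h f = Abs_ncps (\<lambda>w. h (ncoeff f w))"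

definition fps_to_fract :: "'a::idom fps \<Rightarrow> 'a fract fps" where
  "fps_to_fract p = Abs_fps (\<lambda>j. to_fract (fps_nth p j))"

text \<open>The order of the zero series is \<open>\<infinity>\<close>.\<close>

definition nc_order :: "('n, 'a::zero) ncps \<Rightarrow> enat" where
  "nc_order f = (INF w\<in>{w. ncoeff f w \<noteq> 0}. enat (length w))"

definition nc_vec_order :: "('n \<Rightarrow> ('n, 'a::zero) ncps) \<Rightarrow> enat" where
  "nc_vec_order U = (INF i. nc_order (U i))"

text \<open>Infinite sums over \<open>k[[t]]\<close> are taken coefficientwise with respect to the words in \<open>z\<close>; each
  coefficient is an unordered sum in the \<open>t\<close>-adic metric topology on \<^typ>\<open>'a fps\<close>.\<close>

definition nc_has_sum ::
  "('i \<Rightarrow> ('n, 'a::ring_1 fps) ncps) \<Rightarrow> 'i set \<Rightarrow> ('n, 'a fps) ncps \<Rightarrow> bool" where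
  "nc_has_sum f A S \<longleftrightarrow> (\<forall>w. ((\<lambda>x. ncoeff (f x) w) has_sum ncoeff S w) A)"

text \<open>Substitution of \<open>U\<^sub>i\<close> for \<open>z\<^sub>i\<close>. It is meaningful for \<open>U\<close> of order at least 1; then a
  word \<open>v\<close> of \<open>f\<close> contributes only to words of length at least that of \<open>v\<close>, which justifies
  truncating the sum over all words \<open>v\<close>.\<close>

definition nc_subst :: "('n::finite, 'a::ring_1) ncps \<Rightarrow> ('n \<Rightarrow> ('n, 'a) ncps) \<Rightarrow> ('n, 'a) ncps" where
  "nc_subst f U = Abs_ncps (\<lambda>w. \<Sum>v | length v \<le> length w.
     ncoeff f v * ncoeff (prod_list (map U v)) w)"

definition is_inverse_map ::
  "('n::finite \<Rightarrow> ('n, 'a::ring_1) ncps) \<Rightarrow> ('n \<Rightarrow> ('n, 'a) ncps) \<Rightarrow> bool" where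
  "is_inverse_map F G \<longleftrightarrow> 1 \<le> nc_vec_order F \<and> 1 \<le> nc_vec_order G \<and>
     (\<forall>i. nc_subst (F i) G = nc_var i) \<and> (\<forall>i. nc_subst (G i) F = nc_var i)"

definition nc_derivation :: "(('n, 'a::comm_ring_1) ncps \<Rightarrow> ('n, 'a) ncps) \<Rightarrow> bool" where
  "nc_derivation D \<longleftrightarrow>
     (\<forall>f g. D (f + g) = D f + D g) \<and>
     (\<forall>c f. D (nc_smult c f) = nc_smult c (D f)) \<and>
     (\<forall>f g. D (f * g) = D f * g + f * D g)"

text \<open>The derivation \<open>[u \<partial>/\<partial>z]\<close>. With finitely many variables no continuity requirement is
  needed for uniqueness: every series is its constant term plus a finite sum of \<open>z\<^sub>i f\<^sub>i\<close>.\<close>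

definition nc_deriv ::
  "('n::finite \<Rightarrow> ('n, 'a::comm_ring_1) ncps) \<Rightarrow> ('n, 'a) ncps \<Rightarrow> ('n, 'a) ncps" where
  "nc_deriv u = (THE D. nc_derivation D \<and> (\<forall>i. D (nc_var i) = u i))"


section \<open>Planar rooted trees\<close>

text \<open>Nonempty planar rooted trees up to isomorphism: \<open>B_plus [T\<^sub>1, \<dots>, T\<^sub>d]\<close> has a root whose
  ordered children are the roots of the \<open>T\<^sub>i\<close>, so \<open>B_plus []\<close> is the one-vertex tree. Trees that may
  be empty are of type \<open>ptree option\<close>, with \<open>None\<close> the empty tree. Deleting leaves from a binary
  tree can leave vertices with one child, hence the general arity.\<close>

datatype ptree = B_plus "ptree list"

fun binary_ptree :: "ptree \<Rightarrow> bool" where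
  "binary_ptree (B_plus ts) \<longleftrightarrow> (ts = [] \<or> length ts = 2) \<and> (\<forall>T\<in>set ts. binary_ptree T)"

fun vertices_ptree :: "ptree \<Rightarrow> nat" where
  "vertices_ptree (B_plus ts) = 1 + sum_list (map vertices_ptree ts)"

fun leaves_ptree :: "ptree \<Rightarrow> nat" where
  "leaves_ptree (B_plus ts) = (if ts = [] then 1 else sum_list (map leaves_ptree ts))"

fun fact_ptree :: "ptree \<Rightarrow> nat" where
  "fact_ptree (B_plus ts) = vertices_ptree (B_plus ts) * prod_list (map fact_ptree ts)"

fun prune_ptree :: "ptree \<Rightarrow> ptree option" where
  "prune_ptree (B_plus ts) =
     (if ts = [] then None
      else Some (B_plus (concat (map (\<lambda>T. case prune_ptree T of None \<Rightarrow> [] | Some T' \<Rightarrow> [T']) ts))))"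

definition binary_trees :: "ptree option set" where
  "binary_trees = insert None (Some ` {T. binary_ptree T})"

definition vertices :: "ptree option \<Rightarrow> nat" where
  "vertices T = (case T of None \<Rightarrow> 0 | Some T' \<Rightarrow> vertices_ptree T')"

definition leaves :: "ptree option \<Rightarrow> nat" where
  "leaves T = (case T of None \<Rightarrow> 0 | Some T' \<Rightarrow> leaves_ptree T')"

definition tree_fact :: "ptree option \<Rightarrow> nat" where
  "tree_fact T = (case T of None \<Rightarrow> 1 | Some T' \<Rightarrow> fact_ptree T')"

definition prune :: "ptree option \<Rightarrow> ptree option" where
  "prune T = (case T of None \<Rightarrow> None | Some T' \<Rightarrow> prune_ptree T')"

text \<open>The last equation is a dummy value for trees that are not binary.\<close>

fun N_ptree :: "('n::finite \<Rightarrow> ('n, 'a::comm_ring_1) ncps) \<Rightarrow> ptree \<Rightarrow> 'n \<Rightarrow> ('n, 'a) ncps" where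
  "N_ptree H (B_plus []) = H"
| "N_ptree H (B_plus [T1, T2]) = (\<lambda>i. nc_deriv (N_ptree H T1) (N_ptree H T2 i))"
| "N_ptree H T = (\<lambda>i. 0)"

definition N_tree ::
  "('n::finite \<Rightarrow> ('n, 'a::comm_ring_1) ncps) \<Rightarrow> ptree option \<Rightarrow> 'n \<Rightarrow> ('n, 'a) ncps" where
  "N_tree H T = (case T of None \<Rightarrow> nc_var | Some T' \<Rightarrow> N_ptree H T')"

end

theory Submission
  imports Defs
begin

text \<open>
  The operator \<open>\<Delta> = \<partial>/\<partial>t - [N \<partial>/\<partial>z]\<close> is a derivation over \<open>k\<close> that maps
  \<open>G = z + t N\<close> to \<open>t \<Delta>(N)\<close>. On the other hand \<open>N = H(G)\<close>, so by the Leibniz rule every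
  power of \<open>t\<close> dividing \<open>\<Delta>(G)\<close> also divides \<open>\<Delta>(N)\<close>. Hence \<open>\<Delta>(N)\<close> is divisible by all powers
  of \<open>t\<close>, that is, \<open>\<partial>N/\<partial>t = [N \<partial>/\<partial>z] N\<close>. Comparing coefficients of powers of \<open>t\<close> gives
  \<open>(m - 1) N\<^sub>m = (\<Sum>k+l=m. [N\<^sub>k \<partial>/\<partial>z] N\<^sub>l)\<close> with \<open>N\<^sub>1 = H\<close>. The tree sums satisfy the same
  recursion, because deleting the leaves of a nonempty binary tree \<open>T\<close> leaves \<open>l(T) - 1\<close>
  vertices, which accounts for the factor \<open>1/(m - 1)\<close>.
\<close>

section \<open>Coefficientwise arithmetic\<close>

lemma ncoeff_0 [simp]: "ncoeff 0 w = 0"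
  by (simp add: zero_ncps_def)

lemma ncoeff_add [simp]: "ncoeff (f + g) w = ncoeff f w + ncoeff g w"
  by (simp add: plus_ncps_def)

lemma ncoeff_diff [simp]: "ncoeff (f - g) w = ncoeff f w - ncoeff g w"
  by (simp add: minus_ncps_def)

lemma ncoeff_uminus [simp]: "ncoeff (- f) w = - ncoeff f w"
  by (simp add: uminus_ncps_def)

lemma ncoeff_1: "ncoeff 1 w = (if w = [] then 1 else 0)"
  by (simp add: one_ncps_def)

lemma ncoeff_smult [simp]: "ncoeff (nc_smult c f) w = c * ncoeff f w"
  by (simp add: nc_smult_def)

lemma ncoeff_map [simp]: "ncoeff (nc_map h f) w = h (ncoeff f w)"
  by (simp add: nc_map_def)

lemma ncoeff_var: "ncoeff (nc_var i) w = (if w = [i] then 1 else 0)"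
  by (simp add: nc_var_def)

lemma ncoeff_sum [simp]: "ncoeff (sum f A) w = (\<Sum>x\<in>A. ncoeff (f x) w)"
  by (induction A rule: infinite_finite_induct) simp_all

lemma ncoeff_times: "ncoeff (f * g) w = (\<Sum>i=0..length w. ncoeff f (take i w) * ncoeff g (drop i w))"
  by (simp add: times_ncps_def)

lemma nc_smult_times: "nc_smult c f * g = nc_smult c (f * g)"
  by (rule ncps_eqI) (simp add: ncoeff_times sum_distrib_left mult.assoc)

lemma times_nc_smult:
  fixes c :: "'a::comm_ring_1"
  shows "f * nc_smult c g = nc_smult c (f * g)"
  by (rule ncps_eqI) (simp add: ncoeff_times sum_distrib_left mult.left_commute)

lemma nc_smult_nc_smult [simp]: "nc_smult c (nc_smult d f) = nc_smult (c * d) f"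
  by (rule ncps_eqI) (simp add: mult.assoc)

lemma nc_smult_sum_right: "nc_smult c (sum f A) = (\<Sum>x\<in>A. nc_smult c (f x))"
  by (rule ncps_eqI) (simp add: sum_distrib_left)

lemma nc_smult_1 [simp]: "nc_smult 1 f = f"
  by (rule ncps_eqI) simp

text \<open>The left cofactor of the variable \<open>a\<close>. Passing to it shortens a word by one
  letter, so identities of series can be proved by induction on the word with the series left
  arbitrary.\<close>

definition nc_tail :: "'n \<Rightarrow> ('n, 'a) ncps \<Rightarrow> ('n, 'a) ncps" where
  "nc_tail a f = Abs_ncps (\<lambda>w. ncoeff f (a # w))"

lemma ncoeff_tail [simp]: "ncoeff (nc_tail a f) w = ncoeff f (a # w)"
  by (simp add: nc_tail_def)

lemma nc_tail_add [simp]: "nc_tail a (f + g) = nc_tail a f + nc_tail a g"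
  by (rule ncps_eqI) simp

lemma nc_tail_smult [simp]: "nc_tail a (nc_smult c f) = nc_smult c (nc_tail a f)"
  by (rule ncps_eqI) simp

lemma nc_tail_map [simp]: "nc_tail a (nc_map h f) = nc_map h (nc_tail a f)"
  by (rule ncps_eqI) simp

lemma nc_tail_1 [simp]: "nc_tail a 1 = 0"
  by (rule ncps_eqI) (simp add: ncoeff_1)

lemma nc_tail_var: "nc_tail a (nc_var i) = (if a = i then 1 else 0)"
  by (rule ncps_eqI) (simp add: ncoeff_var ncoeff_1)

lemma ncoeff_times_Nil [simp]: "ncoeff (f * g) [] = ncoeff f [] * ncoeff g []"
  by (simp add: ncoeff_times)

lemma ncoeff_times_Cons:
  "ncoeff (f * g) (a # w) = ncoeff f [] * ncoeff g (a # w) + ncoeff (nc_tail a f * g) w"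
  by (simp only: ncoeff_times length_Cons sum.atLeast0_atMost_Suc_shift) simp

text \<open>The term of the Cauchy product with empty left factor is split off. The tail is thus a
  derivation twisted by the constant term, as for Fox derivatives.\<close>

lemma nc_tail_times: "nc_tail a (f * g) = nc_tail a f * g + nc_smult (ncoeff f []) (nc_tail a g)"
  by (rule ncps_eqI) (simp add: ncoeff_times_Cons add.commute)

lemma ncoeff_times_cong:
  assumes "\<And>v. length v \<le> length w \<Longrightarrow> ncoeff g v = ncoeff g' v"
  shows "ncoeff (f * g) w = ncoeff (f * g') w"
  unfolding ncoeff_times by (intro sum.cong refl) (simp add: assms)

text \<open>A nonempty word has exactly one first letter, so exactly one summand reaches it;
  finiteness of the index type makes the sum legitimate.\<close>

lemma ncps_decompose:
  fixes f :: "('n::finite, 'a::comm_ring_1) ncps"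
  shows "f = nc_smult (ncoeff f []) 1 + (\<Sum>i\<in>UNIV. nc_var i * nc_tail i f)"
proof (rule ncps_eqI)
  fix w
  show "ncoeff f w = ncoeff (nc_smult (ncoeff f []) 1 + (\<Sum>i\<in>UNIV. nc_var i * nc_tail i f)) w"
  proof (cases w)
    case Nil
    then show ?thesis by (simp add: ncoeff_1 ncoeff_var)
  next
    case (Cons a v)
    have "ncoeff (nc_var i * nc_tail i f) (a # v) = (if i = a then ncoeff f (a # v) else 0)" for i
      by (simp add: ncoeff_times_Cons ncoeff_var nc_tail_var)
    then show ?thesis
      by (simp add: Cons ncoeff_1)
  qed
qed


section \<open>The derivation of a vector of series\<close>

text \<open>The recursion comes from \<open>f = f\<^sub>0 + (\<Sum>i. z\<^sub>i f\<^sub>i)\<close>, where \<open>f\<^sub>i\<close> is \<^term>\<open>nc_tail i f\<close>.\<close>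

primrec vder_coeff ::
  "('n::finite \<Rightarrow> ('n, 'a::comm_ring_1) ncps) \<Rightarrow> 'n list \<Rightarrow> ('n, 'a) ncps \<Rightarrow> 'a" where
  "vder_coeff u [] f = ncoeff (\<Sum>i\<in>UNIV. u i * nc_tail i f) []"
| "vder_coeff u (a # w) f =
     ncoeff (\<Sum>i\<in>UNIV. u i * nc_tail i f) (a # w) + vder_coeff u w (nc_tail a f)"

definition vder ::
  "('n::finite \<Rightarrow> ('n, 'a::comm_ring_1) ncps) \<Rightarrow> ('n, 'a) ncps \<Rightarrow> ('n, 'a) ncps" where
  "vder u f = Abs_ncps (\<lambda>w. vder_coeff u w f)"

lemma ncoeff_vder_Nil: "ncoeff (vder u f) [] = ncoeff (\<Sum>i\<in>UNIV. u i * nc_tail i f) []"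
  by (simp add: vder_def)

lemma nc_tail_vder:
  "nc_tail a (vder u f) = nc_tail a (\<Sum>i\<in>UNIV. u i * nc_tail i f) + vder u (nc_tail a f)"
  by (rule ncps_eqI) (simp add: vder_def)

lemma ncoeff_vder_Cons:
  "ncoeff (vder u f) (a # w) =
     ncoeff (\<Sum>i\<in>UNIV. u i * nc_tail i f) (a # w) + ncoeff (vder u (nc_tail a f)) w"
  by (simp add: vder_def)

lemma vder_add: "vder u (f + g) = vder u f + vder u g"
proof (rule ncps_eqI)
  fix w show "ncoeff (vder u (f + g)) w = ncoeff (vder u f + vder u g) w"
    by (induction w arbitrary: f g)
      (simp_all add: ncoeff_vder_Nil ncoeff_vder_Cons distrib_left sum.distrib)
qed

lemma vder_smult: "vder u (nc_smult c f) = nc_smult c (vder u f)"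
proof (rule ncps_eqI)
  fix w show "ncoeff (vder u (nc_smult c f)) w = ncoeff (nc_smult c (vder u f)) w"
    by (induction w arbitrary: f)
      (simp_all add: ncoeff_vder_Nil ncoeff_vder_Cons times_nc_smult sum_distrib_left distrib_left
         mult.left_commute)
qed

lemma vder_times: "vder u (f * g) = vder u f * g + f * vder u g"
proof (rule ncps_eqI)
  fix w
  \<comment> \<open>The first-letter part inherits the twisted Leibniz rule of the tails. Its
    constant-term summand later combines with the one from \<open>nc_tail a (f * g)\<close> into
    \<open>ncoeff f []\<close> times the derivative of \<open>g\<close>.\<close>
  have split: "(\<Sum>i\<in>UNIV. u i * nc_tail i (f * g)) =
      (\<Sum>i\<in>UNIV. u i * nc_tail i f) * g + nc_smult (ncoeff f []) (\<Sum>i\<in>UNIV. u i * nc_tail i g)" for f g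
    by (simp add: nc_tail_times distrib_left sum.distrib sum_distrib_right mult.assoc
        times_nc_smult nc_smult_sum_right)
  show "ncoeff (vder u (f * g)) w = ncoeff (vder u f * g + f * vder u g) w"
  proof (induction w arbitrary: f g)
    case Nil
    show ?case
      unfolding ncoeff_vder_Nil split by (simp add: ncoeff_vder_Nil)
  next
    case (Cons a w)
    have "ncoeff (vder u (f * g)) (a # w) =
        ncoeff ((\<Sum>i\<in>UNIV. u i * nc_tail i f) * g) (a # w)
        + ncoeff f [] * ncoeff (vder u g) (a # w)
        + ncoeff (vder u (nc_tail a f) * g + nc_tail a f * vder u g) w"
      unfolding ncoeff_vder_Cons split
      by (simp add: nc_tail_times vder_add vder_smult Cons.IH distrib_left)
    also have "\<dots> = ncoeff (vder u f * g + f * vder u g) (a # w)"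
      by (simp add: ncoeff_times_Cons nc_tail_vder ncoeff_vder_Nil distrib_right)
    finally show ?case .
  qed
qed

lemma vder_var: "vder u (nc_var i) = u i"
proof (rule ncps_eqI)
  have vder_0: "vder u 0 = 0"
    using vder_add[of u 0 0] by simp
  have vder_1: "vder u 1 = 0"
    using vder_times[of u 1 1] by simp
  have sum: "(\<Sum>j\<in>UNIV. u j * nc_tail j (nc_var i)) = u i"
    by (simp add: nc_tail_var if_distrib cong: if_cong)
  fix w show "ncoeff (vder u (nc_var i)) w = ncoeff (u i) w"
    by (cases w) (simp_all only: ncoeff_vder_Nil ncoeff_vder_Cons sum,
        simp add: nc_tail_var vder_0 vder_1)
qed

text \<open>A derivation kills constants, so one decomposition expresses \<open>D f\<close> through
  the values at the variables and the terms \<open>z_i * D f_i\<close>. The latter see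
  \<open>D f_i\<close> only at shorter words, which drives an induction on the word.\<close>

lemma nc_derivation_unique:
  fixes D E :: "('n::finite, 'a::comm_ring_1) ncps \<Rightarrow> ('n, 'a) ncps"
  assumes D: "nc_derivation D" and E: "nc_derivation E" and eq: "\<And>i. D (nc_var i) = E (nc_var i)"
  shows "D = E"
proof
  fix f
  have expand: "D' f = (\<Sum>i\<in>UNIV. D' (nc_var i) * nc_tail i f + nc_var i * D' (nc_tail i f))"
    if D': "nc_derivation D'" for D' and f :: "('n, 'a) ncps"
  proof -
    have add: "D' (f + g) = D' f + D' g" and smult: "D' (nc_smult c f) = nc_smult c (D' f)"
      and times: "D' (f * g) = D' f * g + f * D' g" for f g c
      using D' by (auto simp: nc_derivation_def)
    have zero: "D' 0 = 0" using add[of 0 0] by simp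
    have one: "D' 1 = 0" using times[of 1 1] by simp
    have sum: "D' (sum g A) = (\<Sum>x\<in>A. D' (g x))" for g and A :: "'n set"
      by (induction A rule: infinite_finite_induct) (simp_all add: add zero)
    have "D' f = D' (nc_smult (ncoeff f []) 1 + (\<Sum>i\<in>UNIV. nc_var i * nc_tail i f))"
      by (subst ncps_decompose[of f]) simp
    also have "\<dots> = nc_smult (ncoeff f []) 0 + (\<Sum>i\<in>UNIV. D' (nc_var i * nc_tail i f))"
      by (simp only: add smult one sum)
    also have "nc_smult (ncoeff f []) 0 = 0"
      by (rule ncps_eqI) simp
    finally show ?thesis by (simp add: times)
  qed
  show "D f = E f"
  proof (rule ncps_eqI)
    fix w show "ncoeff (D f) w = ncoeff (E f) w"
    proof (induction w arbitrary: f)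
      case Nil
      show ?case
        by (subst expand[OF D], subst expand[OF E]) (simp add: eq ncoeff_var)
    next
      case (Cons a w)
      have "ncoeff (nc_var i * D (nc_tail i f)) (a # w) = ncoeff (nc_var i * E (nc_tail i f)) (a # w)"
        for i
        by (simp add: ncoeff_times_Cons nc_tail_var ncoeff_var Cons.IH)
      then show ?case
        by (subst expand[OF D], subst expand[OF E]) (simp add: eq)
    qed
  qed
qed

lemma nc_derivation_vder: "nc_derivation (vder u)"
  by (simp add: nc_derivation_def vder_add vder_smult vder_times)

text \<open>Existence and uniqueness together discharge the definite description, so all later work
  uses the recursive form.\<close>

lemma nc_deriv_eq_vder: "nc_deriv u = vder u"
  unfolding nc_deriv_def
  using nc_derivation_vder vder_var by (intro the_equality) (auto intro!: nc_derivation_unique)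

lemma vder_sum: "vder u (sum f A) = (\<Sum>x\<in>A. vder u (f x))"
proof (induction A rule: infinite_finite_induct)
  have "vder u 0 = 0"
    using vder_add[of u 0 0] by simp
  then show "\<And>A. infinite A \<Longrightarrow> vder u (sum f A) = (\<Sum>x\<in>A. vder u (f x))"
    and "vder u (sum f {}) = (\<Sum>x\<in>{}. vder u (f x))" by simp_all
qed (simp add: vder_add)

lemma vder_sum_left:
  "vder (\<lambda>i. \<Sum>x\<in>A. nc_smult (c x) (U x i)) f = (\<Sum>x\<in>A. nc_smult (c x) (vder (U x) f))"
proof (rule ncps_eqI)
  have A: "(\<Sum>i\<in>UNIV. (\<Sum>x\<in>A. nc_smult (c x) (U x i)) * nc_tail i f) =
      (\<Sum>x\<in>A. nc_smult (c x) (\<Sum>i\<in>UNIV. U x i * nc_tail i f))" for f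
    unfolding nc_smult_sum_right sum_distrib_right nc_smult_times by (rule sum.swap)
  fix w show "ncoeff (vder (\<lambda>i. \<Sum>x\<in>A. nc_smult (c x) (U x i)) f) w =
      ncoeff (\<Sum>x\<in>A. nc_smult (c x) (vder (U x) f)) w"
    by (induction w arbitrary: f)
      (simp_all only: ncoeff_vder_Nil ncoeff_vder_Cons A ncoeff_sum ncoeff_smult distrib_left
         sum.distrib)
qed

text \<open>Replacing one letter by a series, possibly with a constant term, shortens a word by at
  most one letter; hence the bound \<open>Suc (length w)\<close>. This locality allows infinite
  series to be truncated before differentiating.\<close>

lemma ncoeff_vder_cong:
  assumes "\<And>v. length v \<le> Suc (length w) \<Longrightarrow> ncoeff f v = ncoeff g v"
  shows "ncoeff (vder u f) w = ncoeff (vder u g) w"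
  using assms
proof (induction w arbitrary: f g)
  case Nil
  then show ?case by (simp add: ncoeff_vder_Nil)
next
  case (Cons a w)
  have "ncoeff (u i * nc_tail i f) (a # w) = ncoeff (u i * nc_tail i g) (a # w)" for i
    by (rule ncoeff_times_cong) (use Cons.prems in simp)
  moreover have "ncoeff (vder u (nc_tail a f)) w = ncoeff (vder u (nc_tail a g)) w"
    by (rule Cons.IH) (use Cons.prems in simp)
  ultimately show ?case
    by (simp add: ncoeff_vder_Cons)
qed

section \<open>Compatibility with the fraction field and with coefficients in
  \<open>t\<close>\<close>

lemma nc_map_to_fract_times: "nc_map to_fract (f * g) = nc_map to_fract f * nc_map to_fract g"
  by (rule ncps_eqI) (simp add: ncoeff_times)

lemma nc_map_to_fract_vder:
  "nc_map to_fract (vder u f) = vder (\<lambda>i. nc_map to_fract (u i)) (nc_map to_fract f)"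
proof (rule ncps_eqI)
  fix w show "ncoeff (nc_map to_fract (vder u f)) w =
      ncoeff (vder (\<lambda>i. nc_map to_fract (u i)) (nc_map to_fract f)) w"
    by (induction w arbitrary: f)
      (simp_all add: ncoeff_vder_Nil ncoeff_vder_Cons flip: nc_map_to_fract_times)
qed

lemma fps_nth_ncoeff_times:
  "fps_nth (ncoeff (f * g) w) m =
     (\<Sum>k=0..m. ncoeff (nc_map (\<lambda>p. fps_nth p k) f * nc_map (\<lambda>p. fps_nth p (m - k)) g) w)"
  by (simp add: ncoeff_times fps_sum_nth fps_mult_nth sum.swap[of _ "{0..m}"])

text \<open>The derivation is bilinear in \<open>u\<close> and \<open>f\<close>, so powers of
  \<open>t\<close> multiply as in a Cauchy product. This turns the differential equation into a
  recursion.\<close>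

lemma fps_nth_ncoeff_vder:
  "fps_nth (ncoeff (vder u f) w) m =
     (\<Sum>k=0..m. ncoeff (vder (\<lambda>i. nc_map (\<lambda>p. fps_nth p k) (u i)) (nc_map (\<lambda>p. fps_nth p (m - k)) f)) w)"
proof (induction w arbitrary: f)
  case Nil
  show ?case
    by (simp only: ncoeff_vder_Nil ncoeff_sum fps_sum_nth fps_nth_ncoeff_times nc_tail_map
        sum.swap[of _ UNIV "{0..m}"])
next
  case (Cons a w)
  show ?case
    by (simp only: ncoeff_vder_Cons ncoeff_sum fps_sum_nth fps_nth_ncoeff_times nc_tail_map
        sum.swap[of _ UNIV "{0..m}"] fps_add_nth Cons.IH sum.distrib)
qed


section \<open>The Burgers equation of the inverse map\<close>

lemma ncoeff_Nil_eq_0: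
  fixes G :: "'n \<Rightarrow> ('n, 'a::zero) ncps"
  assumes "1 \<le> nc_vec_order G"
  shows "ncoeff (G i) [] = 0"
proof (rule ccontr)
  assume "ncoeff (G i) [] \<noteq> 0"
  then have "nc_order (G i) \<le> enat (length ([] :: 'n list))"
    unfolding nc_order_def by (intro INF_lower) simp
  moreover have "nc_vec_order G \<le> nc_order (G i)"
    unfolding nc_vec_order_def by (rule INF_lower) simp
  ultimately have "1 \<le> enat (length ([] :: 'n list))"
    using assms by (meson order_trans)
  then show False
    by (simp add: one_enat_def)
qed

section \<open>Substitution of series without constant term\<close>

lemma ncoeff_prod_list_eq_0:
  assumes "\<And>i. ncoeff (G i) [] = 0" and "length w < length v"
  shows "ncoeff (prod_list (map G v)) w = 0"
  using assms(2)
proof (induction v arbitrary: w)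
  case (Cons i v)
  have "ncoeff (G i) (take k w) * ncoeff (prod_list (map G v)) (drop k w) = 0" if "k \<le> length w" for k
    using Cons that by (cases "k = 0") (simp_all add: assms(1))
  then show ?case
    by (simp add: ncoeff_times)
qed simp

text \<open>Longer words contribute nothing, so a single finite sum represents the substitution at
  all words of length up to \<open>M\<close>, and operators can be applied to that sum.\<close>

lemma ncoeff_subst:
  fixes G :: "'n::finite \<Rightarrow> ('n, 'a::ring_1) ncps"
  assumes "\<And>i. ncoeff (G i) [] = 0" and "length w \<le> M"
  shows "ncoeff (nc_subst f G) w =
    ncoeff (\<Sum>v | length v \<le> M. nc_smult (ncoeff f v) (prod_list (map G v))) w"
proof -
  have "finite {v :: 'n list. length v \<le> M}"
    using finite_lists_length_le[of "UNIV :: 'n set"] by simp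
  then show ?thesis
    unfolding nc_subst_def ncoeff_sum ncoeff_smult ncoeff_Abs_ncps using assms
    by (intro sum.mono_neutral_left) (auto simp: ncoeff_prod_list_eq_0)
qed

lemma nc_subst_diff: "nc_subst (f - g) G = nc_subst f G - nc_subst g G"
  by (rule ncps_eqI) (simp add: nc_subst_def left_diff_distrib sum_subtractf)

lemma nc_subst_smult: "nc_subst (nc_smult c f) G = nc_smult c (nc_subst f G)"
  by (rule ncps_eqI) (simp add: nc_subst_def sum_distrib_left mult.assoc)

lemma nc_subst_var:
  fixes G :: "'n::finite \<Rightarrow> ('n, 'a::ring_1) ncps"
  assumes "\<And>i. ncoeff (G i) [] = 0"
  shows "nc_subst (nc_var i) G = G i"
proof (rule ncps_eqI)
  fix w :: "'n list"
  have fin: "finite {v :: 'n list. length v \<le> length w}"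
    using finite_lists_length_le[of "UNIV :: 'n set"] by simp
  have "ncoeff (nc_subst (nc_var i) G) w =
      (\<Sum>v | length v \<le> length w. if v = [i] then ncoeff (G i) w else 0)"
    unfolding nc_subst_def ncoeff_Abs_ncps by (intro sum.cong) (auto simp: ncoeff_var)
  also have "\<dots> = ncoeff (G i) w"
    \<comment> \<open>For \<open>w = []\<close> the truncated sum misses the word
      \<open>[i]\<close>, but there the coefficient of \<open>G i\<close> is zero.\<close>
    using assms[of i] fin by (cases w) (simp_all add: sum.delta')
  finally show "ncoeff (nc_subst (nc_var i) G) w = ncoeff (G i) w" .
qed

text \<open>The operator \<open>\<partial>/\<partial>t - [N \<partial>/\<partial>z]\<close>; it is a derivation over \<open>k\<close>, but not
  over \<open>k[[t]]\<close>, since it maps \<open>t\<close> to \<open>1\<close>.\<close>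

definition burgers_op ::
  "('n::finite \<Rightarrow> ('n, 'a::comm_ring_1 fps) ncps) \<Rightarrow> ('n, 'a fps) ncps \<Rightarrow> ('n, 'a fps) ncps" where
  "burgers_op N f = nc_map fps_deriv f - vder N f"

lemma burgers_op_add: "burgers_op N (f + g) = burgers_op N f + burgers_op N g"
  by (rule ncps_eqI) (simp add: burgers_op_def vder_add)

lemma burgers_op_smult:
  "burgers_op N (nc_smult c f) = nc_smult c (burgers_op N f) + nc_smult (fps_deriv c) f"
  by (rule ncps_eqI) (simp add: burgers_op_def vder_smult algebra_simps)

lemma burgers_op_times: "burgers_op N (f * g) = burgers_op N f * g + f * burgers_op N g"
proof -
  have "nc_map fps_deriv (f * g) = nc_map fps_deriv f * g + f * nc_map fps_deriv g"
    by (rule ncps_eqI) (simp add: ncoeff_times fps_deriv_sum sum.distrib add.commute)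
  then show ?thesis
    by (simp add: burgers_op_def vder_times algebra_simps)
qed

lemma burgers_op_var: "burgers_op N (nc_var i) = - N i"
  by (rule ncps_eqI) (simp add: burgers_op_def vder_var ncoeff_var)

lemma burgers_op_sum: "burgers_op N (sum f A) = (\<Sum>x\<in>A. burgers_op N (f x))"
  by (rule ncps_eqI) (simp add: burgers_op_def vder_sum fps_deriv_sum sum_subtractf)

lemma ncoeff_burgers_op_cong:
  assumes "\<And>v. length v \<le> Suc (length w) \<Longrightarrow> ncoeff f v = ncoeff g v"
  shows "ncoeff (burgers_op N f) w = ncoeff (burgers_op N g) w"
  using assms by (simp add: burgers_op_def ncoeff_vder_cong[of w f g])

section \<open>Divisibility of coefficients by powers of \<open>t\<close>\<close>

lemma dvd_ncoeff_times_left: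
  assumes "\<And>w. (c::'a::comm_ring_1) dvd ncoeff f w"
  shows "c dvd ncoeff (f * g) w"
  unfolding ncoeff_times by (intro dvd_sum dvd_mult2 assms)

lemma dvd_ncoeff_times_right:
  assumes "\<And>w. (c::'a::comm_ring_1) dvd ncoeff g w"
  shows "c dvd ncoeff (f * g) w"
  unfolding ncoeff_times by (intro dvd_sum dvd_mult assms)

lemma dvd_burgers_op_prod_list:
  assumes "\<And>i w. c dvd ncoeff (burgers_op N (G i)) w"
  shows "c dvd ncoeff (burgers_op N (prod_list (map G v))) w"
proof (induction v arbitrary: w)
  case Nil
  have "burgers_op N 1 = 0"
    using burgers_op_times[of N 1 1] by simp
  then show ?case by simp
next
  case (Cons i v)
  then show ?case
    by (simp add: burgers_op_times dvd_add dvd_ncoeff_times_left dvd_ncoeff_times_right assms)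
qed

text \<open>The coefficients of \<open>H\<close> are constant in \<open>t\<close>, so the operator
  acts only on the products of the \<open>G i\<close>, where the Leibniz rule applies.\<close>

lemma dvd_burgers_op_subst:
  fixes H :: "('n::finite, 'a::comm_ring_1) ncps"
  assumes "\<And>i. ncoeff (G i) [] = 0"
    and "\<And>i w. c dvd ncoeff (burgers_op N (G i)) w"
  shows "c dvd ncoeff (burgers_op N (nc_subst (nc_map fps_const H) G)) w"
proof -
  \<comment> \<open>One letter beyond \<open>length w\<close> is kept because the derivation can
    lower the length by one.\<close>
  let ?P = "\<Sum>v | length v \<le> Suc (length w). nc_smult (fps_const (ncoeff H v)) (prod_list (map G v))"
  have "ncoeff (burgers_op N (nc_subst (nc_map fps_const H) G)) w = ncoeff (burgers_op N ?P) w"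
    using ncoeff_subst[OF assms(1), where f = "nc_map fps_const H" and M = "Suc (length w)"]
    by (intro ncoeff_burgers_op_cong) simp
  also have "c dvd \<dots>"
    by (simp add: burgers_op_sum burgers_op_smult)
      (intro dvd_sum dvd_mult dvd_burgers_op_prod_list assms(2))
  finally show ?thesis .
qed

text \<open>The equation \<open>F(G) = z\<close> reads \<open>G - t H(G) = z\<close>, while
  \<open>G = z + t N\<close>; the factor \<open>t\<close> cancels.\<close>

lemma inverse_map_fixed_point:
  fixes H :: "'n::finite \<Rightarrow> ('n, 'a::idom) ncps"
  assumes F: "\<And>i. F i = nc_var i - nc_smult fps_X (nc_map fps_const (H i))"
    and inverse: "is_inverse_map F G"
    and G: "\<And>i. G i = nc_var i + nc_smult fps_X (N i)"
  shows "N i = nc_subst (nc_map fps_const (H i)) G"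
proof (rule ncps_eqI)
  fix w
  have G_Nil: "ncoeff (G i) [] = 0" for i
    using inverse by (intro ncoeff_Nil_eq_0) (simp add: is_inverse_map_def)
  have "nc_subst (F i) G = nc_var i"
    using inverse by (simp add: is_inverse_map_def)
  then have "G i - nc_smult fps_X (nc_subst (nc_map fps_const (H i)) G) = nc_var i"
    by (simp add: F nc_subst_diff nc_subst_smult nc_subst_var G_Nil)
  then have "nc_smult fps_X (N i) = nc_smult fps_X (nc_subst (nc_map fps_const (H i)) G)"
    by (simp add: G algebra_simps)
  from arg_cong[OF this, of "\<lambda>f. ncoeff f w"]
  show "ncoeff (N i) w = ncoeff (nc_subst (nc_map fps_const (H i)) G) w"
    by simp
qed

lemma ncoeff_prod_list_var: "ncoeff (prod_list (map nc_var v)) w = (if w = v then 1 else 0)"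
proof (induction v arbitrary: w)
  case Nil
  show ?case by (simp add: ncoeff_1)
next
  case (Cons a v)
  then show ?case
    by (cases w) (simp_all add: ncoeff_times_Cons ncoeff_var nc_tail_var)
qed

lemma fps_nth_0_ncoeff_prod_list:
  "fps_nth (ncoeff (prod_list (map G v)) w) 0 =
     ncoeff (prod_list (map (\<lambda>i. nc_map (\<lambda>p. fps_nth p 0) (G i)) v)) w"
  by (induction v arbitrary: w) (simp_all add: ncoeff_1 ncoeff_times fps_sum_nth)

text \<open>At \<open>t = 0\<close> the map \<open>G\<close> is the identity, so
  \<open>N = H(G)\<close> reduces to \<open>H\<close>.\<close>

lemma inverse_map_at_0:
  fixes H :: "'n::finite \<Rightarrow> ('n, 'a::idom) ncps"
  assumes F: "\<And>i. F i = nc_var i - nc_smult fps_X (nc_map fps_const (H i))"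
    and inverse: "is_inverse_map F G"
    and G: "\<And>i. G i = nc_var i + nc_smult fps_X (N i)"
  shows "nc_map (\<lambda>p. fps_nth p 0) (N i) = H i"
proof (rule ncps_eqI)
  fix w :: "'n list"
  have "nc_map (\<lambda>p. fps_nth p 0) (G i) = nc_var i" for i
    by (rule ncps_eqI) (simp add: G ncoeff_var)
  moreover have "finite {v :: 'n list. length v \<le> length w}"
    using finite_lists_length_le[of "UNIV :: 'n set"] by simp
  ultimately show "ncoeff (nc_map (\<lambda>p. fps_nth p 0) (N i)) w = ncoeff (H i) w"
    by (simp add: inverse_map_fixed_point[OF assms] nc_subst_def fps_sum_nth
        fps_nth_0_ncoeff_prod_list ncoeff_prod_list_var if_distrib cong: if_cong)
qed

lemma burgers_equation:
  fixes H :: "'n::finite \<Rightarrow> ('n, 'a::idom) ncps"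
  assumes F: "\<And>i. F i = nc_var i - nc_smult fps_X (nc_map fps_const (H i))"
    and inverse: "is_inverse_map F G"
    and G: "\<And>i. G i = nc_var i + nc_smult fps_X (N i)"
  shows "nc_map fps_deriv (N i) = vder N (N i)"
proof -
  have G_Nil: "ncoeff (G i) [] = 0" for i
    using inverse by (intro ncoeff_Nil_eq_0) (simp add: is_inverse_map_def)
  \<comment> \<open>The term \<open>- N i\<close> from the variable cancels against
    \<open>N i\<close> from differentiating the factor \<open>t\<close>.\<close>
  have op_G: "burgers_op N (G i) = nc_smult fps_X (burgers_op N (N i))" for i
    by (rule ncps_eqI) (simp add: G burgers_op_add burgers_op_var burgers_op_smult)
  \<comment> \<open>Each round gains one factor: \<open>t^k\<close> divides the operator on
    \<open>N\<close>, so \<open>t^(k+1)\<close> divides it on \<open>G\<close>, hence on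
    \<open>H(G) = N\<close>.\<close>
  have "fps_X ^ k dvd ncoeff (burgers_op N (N i)) w" for k i w
  proof (induction k arbitrary: i w)
    case (Suc k)
    have "fps_X ^ Suc k dvd ncoeff (burgers_op N (G i)) w" for i w
      using Suc by (simp add: op_G mult_dvd_mono)
    then show ?case
      unfolding inverse_map_fixed_point[OF assms, of i] by (intro dvd_burgers_op_subst G_Nil)
  qed simp
  have "ncoeff (burgers_op N (N i)) w = 0" for w
  proof (rule fps_ext)
    fix k
    from \<open>fps_X ^ Suc k dvd ncoeff (burgers_op N (N i)) w\<close>
    obtain p where "ncoeff (burgers_op N (N i)) w = fps_X ^ Suc k * p" ..
    then show "fps_nth (ncoeff (burgers_op N (N i)) w) k = fps_nth 0 k"
      by (simp only: fps_X_power_mult_nth) simp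
  qed
  then show ?thesis
    by (intro ncps_eqI) (simp add: burgers_op_def)
qed

section \<open>The expansion over planar binary trees\<close>

text \<open>Nonempty binary trees graded by leaves, since leaf counts simply add when two trees are
  joined at a root.\<close>

definition btrees :: "nat \<Rightarrow> ptree set" where
  "btrees m = {T. binary_ptree T \<and> leaves_ptree T = m}"

lemma binary_ptree_cases:
  assumes "binary_ptree T"
  obtains "T = B_plus []"
  | T1 T2 where "T = B_plus [T1, T2]" "binary_ptree T1" "binary_ptree T2"
proof (cases T)
  case (B_plus ts)
  show thesis
  proof (cases "ts = []")
    case False
    then obtain T1 T2 where "ts = [T1, T2]"
      using assms B_plus by (auto simp: length_Suc_conv numeral_2_eq_2)
    then show thesis
      using assms B_plus that(2) by simp
  qed (use B_plus that(1) in simp)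
qed

lemma binary_ptree_induct [consumes 1, case_names leaf node]:
  assumes "binary_ptree T" and "P (B_plus [])"
    and "\<And>T1 T2. binary_ptree T1 \<Longrightarrow> binary_ptree T2 \<Longrightarrow> P T1 \<Longrightarrow> P T2 \<Longrightarrow> P (B_plus [T1, T2])"
  shows "P T"
  using assms(1)
proof (induction T)
  case (B_plus ts)
  from B_plus.prems show ?case
    by (cases rule: binary_ptree_cases) (use B_plus.IH assms(2,3) in auto)
qed

lemma leaves_ptree_pos:
  assumes "binary_ptree T"
  shows "0 < leaves_ptree T"
  using assms by (induction rule: binary_ptree_induct) simp_all

lemma Suc_vertices_ptree:
  assumes "binary_ptree T"
  shows "Suc (vertices_ptree T) = 2 * leaves_ptree T"
  using assms by (induction rule: binary_ptree_induct) simp_all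

text \<open>Pruning keeps exactly the inner vertices, one fewer than the leaves in a binary tree;
  the one-vertex tree prunes to the empty tree with count zero.\<close>

lemma Suc_vertices_prune_ptree:
  assumes "binary_ptree T"
  shows "Suc (vertices (prune_ptree T)) = leaves_ptree T"
  using assms
  by (induction rule: binary_ptree_induct) (auto simp: vertices_def split: option.splits)

text \<open>The root survives pruning, so the factorial acquires the number of inner vertices as a
  factor; a subtree pruned to nothing disappears as a child and contributes the factor
  \<open>1\<close>.\<close>

lemma tree_fact_prune_node:
  assumes "binary_ptree T1" "binary_ptree T2"
  shows "tree_fact (prune_ptree (B_plus [T1, T2])) =
    (leaves_ptree T1 + leaves_ptree T2 - 1)
      * (tree_fact (prune_ptree T1) * tree_fact (prune_ptree T2))"
  using assms[THEN Suc_vertices_prune_ptree, symmetric]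
  by (auto simp: vertices_def tree_fact_def algebra_simps split: option.splits)

lemma btrees_1: "btrees (Suc 0) = {B_plus []}"
proof -
  have "T = B_plus []" if T: "binary_ptree T" "leaves_ptree T = Suc 0" for T
    using T(1)
  proof (cases rule: binary_ptree_cases)
    case (2 T1 T2)
    then show ?thesis
      using T(2) leaves_ptree_pos[of T1] leaves_ptree_pos[of T2] by simp
  qed
  then show ?thesis
    by (auto simp: btrees_def)
qed

text \<open>Each subtree of the root has at least one leaf, so the leaf counts are
  \<open>k + 1\<close> and \<open>m - k + 1\<close> with \<open>k \<le> m\<close>.\<close>

lemma btrees_Suc_Suc:
  "btrees (Suc (Suc m)) =
     (\<lambda>(k, T1, T2). B_plus [T1, T2]) ` (SIGMA k:{0..m}. btrees (Suc k) \<times> btrees (Suc (m - k)))"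
  (is "_ = ?node ` ?S")
proof
  show "btrees (Suc (Suc m)) \<subseteq> ?node ` ?S"
  proof
    fix T assume "T \<in> btrees (Suc (Suc m))"
    then have T: "binary_ptree T" "leaves_ptree T = Suc (Suc m)"
      by (simp_all add: btrees_def)
    from T(1) show "T \<in> ?node ` ?S"
    proof (cases rule: binary_ptree_cases)
      case 1
      then show ?thesis using T by simp
    next
      case (2 T1 T2)
      define k where "k = leaves_ptree T1 - 1"
      have "leaves_ptree T1 = Suc k" "leaves_ptree T2 = Suc (m - k)" "k \<le> m"
        using T(2) 2 leaves_ptree_pos[OF 2(2)] leaves_ptree_pos[OF 2(3)] by (simp_all add: k_def)
      then have "(k, T1, T2) \<in> ?S"
        using 2 by (simp add: btrees_def)
      then show ?thesis
        using 2 by force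
    qed
  qed
  show "?node ` ?S \<subseteq> btrees (Suc (Suc m))"
    by (auto simp: btrees_def)
qed

text \<open>The tag \<open>k\<close> can be recovered from the leaf count of
  \<open>T1\<close>.\<close>

lemma inj_on_node:
  "inj_on (\<lambda>(k, T1, T2). B_plus [T1, T2]) (SIGMA k:{0..m}. btrees (Suc k) \<times> btrees (Suc (m - k)))"
  by (auto simp: inj_on_def btrees_def)

lemma finite_btrees: "finite (btrees m)"
proof (induction m rule: less_induct)
  case (less m)
  consider "m = 0" | "m = Suc 0" | m' where "m = Suc (Suc m')"
    by (metis not0_implies_Suc)
  then show ?case
  proof cases
    case 1
    have "btrees 0 = {}"
      using leaves_ptree_pos by (fastforce simp: btrees_def)
    then show ?thesis by (simp add: 1)
  next
    case 2
    then show ?thesis by (simp add: btrees_1)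
  next
    case 3
    then show ?thesis
      unfolding 3 btrees_Suc_Suc
      by (intro finite_imageI finite_SigmaI finite_cartesian_product) (auto simp: 3 intro!: less)
  qed
qed

text \<open>In characteristic zero the recursion determines every \<open>M m\<close> from
  \<open>M 0\<close>. By bilinearity its right side becomes a sum over pairs of trees, which
  regroups as a sum over trees with one more root.\<close>

lemma btrees_expansion:
  fixes M :: "nat \<Rightarrow> 'n::finite \<Rightarrow> ('n, 'a::{field, ring_char_0}) ncps"
  assumes M_0: "\<And>i. M 0 i = H i"
    and M_Suc: "\<And>m i. nc_smult (of_nat (Suc m)) (M (Suc m) i) = (\<Sum>k=0..m. vder (M k) (M (m - k) i))"
  shows "M m i = (\<Sum>T\<in>btrees (Suc m). nc_smult (1 / of_nat (tree_fact (prune_ptree T))) (N_ptree H T i))"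
proof (induction m arbitrary: i rule: less_induct)
  case (less m)
  define W :: "ptree \<Rightarrow> 'a" where "W T = 1 / of_nat (tree_fact (prune_ptree T))" for T
  show ?case
  proof (cases m)
    case 0
    then show ?thesis
      by (simp add: btrees_1 M_0 tree_fact_def)
  next
    case (Suc n)
    \<comment> \<open>Here \<open>Suc n\<close> is \<open>(k + 1) + (n - k + 1) - 1\<close>, the
      vertex count of the pruned joined tree, so it cancels the new factor of the tree
      factorial.\<close>
    have W_node: "of_nat (Suc n) * W (B_plus [T1, T2]) = W T1 * W T2"
      if "k \<le> n" "T1 \<in> btrees (Suc k)" "T2 \<in> btrees (Suc (n - k))" for k T1 T2
    proof -
      have "tree_fact (prune_ptree (B_plus [T1, T2])) =
          Suc n * (tree_fact (prune_ptree T1) * tree_fact (prune_ptree T2))"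
        using that by (subst tree_fact_prune_node) (auto simp: btrees_def)
      then show ?thesis
        unfolding W_def by (simp del: of_nat_Suc mult_Suc prune_ptree.simps)
    qed
    have "nc_smult (of_nat (Suc n)) (M (Suc n) i) = (\<Sum>k=0..n. vder (M k) (M (n - k) i))"
      by (rule M_Suc)
    also have "\<dots> = (\<Sum>k=0..n. \<Sum>T1\<in>btrees (Suc k). \<Sum>T2\<in>btrees (Suc (n - k)).
        nc_smult (W T1 * W T2) (N_ptree H (B_plus [T1, T2]) i))"
    proof (intro sum.cong refl)
      fix k assume "k \<in> {0..n}"
      then have M_k: "M k = (\<lambda>i. \<Sum>T\<in>btrees (Suc k). nc_smult (W T) (N_ptree H T i))"
        and M_nk: "M (n - k) i = (\<Sum>T\<in>btrees (Suc (n - k)). nc_smult (W T) (N_ptree H T i))"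
        using less[of k] less[of "n - k" i] Suc by (auto simp: W_def fun_eq_iff)
      show "vder (M k) (M (n - k) i) = (\<Sum>T1\<in>btrees (Suc k). \<Sum>T2\<in>btrees (Suc (n - k)).
          nc_smult (W T1 * W T2) (N_ptree H (B_plus [T1, T2]) i))"
        unfolding M_k M_nk vder_sum_left
        by (simp add: vder_sum vder_smult nc_smult_sum_right nc_deriv_eq_vder)
    qed
    also have "\<dots> = (\<Sum>(k, T1, T2)\<in>(SIGMA k:{0..n}. btrees (Suc k) \<times> btrees (Suc (n - k))).
        nc_smult (W T1 * W T2) (N_ptree H (B_plus [T1, T2]) i))"
      by (subst sum.Sigma[symmetric])
        (auto simp: finite_btrees sum.cartesian_product split_def)
    also have "\<dots> = (\<Sum>(k, T1, T2)\<in>(SIGMA k:{0..n}. btrees (Suc k) \<times> btrees (Suc (n - k))).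
        nc_smult (of_nat (Suc n) * W (B_plus [T1, T2])) (N_ptree H (B_plus [T1, T2]) i))"
      by (intro sum.cong refl) (auto simp only: mem_Sigma_iff W_node atLeastAtMost_iff prod.case)
    also have "\<dots> = (\<Sum>T\<in>btrees (Suc (Suc n)). nc_smult (of_nat (Suc n) * W T) (N_ptree H T i))"
      unfolding btrees_Suc_Suc by (subst sum.reindex[OF inj_on_node]) (simp add: split_def)
    also have "\<dots> = nc_smult (of_nat (Suc n)) (\<Sum>T\<in>btrees (Suc (Suc n)). nc_smult (W T) (N_ptree H T i))"
      by (simp add: nc_smult_sum_right)
    finally have eq: "nc_smult (of_nat (Suc n)) (M (Suc n) i) =
        nc_smult (of_nat (Suc n)) (\<Sum>T\<in>btrees (Suc (Suc n)). nc_smult (W T) (N_ptree H T i))" .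
    \<comment> \<open>The common factor \<open>of_nat (Suc n)\<close> is nonzero by characteristic
      zero and can be cancelled.\<close>
    show ?thesis
    proof (rule ncps_eqI)
      fix w
      from arg_cong[OF eq, of "\<lambda>f. ncoeff f w"]
      show "ncoeff (M m i) w = ncoeff (\<Sum>T\<in>btrees (Suc m).
          nc_smult (1 / of_nat (tree_fact (prune_ptree T))) (N_ptree H T i)) w"
        unfolding Suc W_def ncoeff_smult by (simp del: of_nat_Suc)
    qed
  qed
qed

section \<open>Passage to the fraction field\<close>

lemma nc_map_to_fract_N_ptree:
  "nc_map to_fract (N_ptree H T i) = N_ptree (\<lambda>i. nc_map to_fract (H i)) T i"
proof (induction H T arbitrary: i rule: N_ptree.induct)
  case (2 H T1 T2)
  then show ?case
    by (simp add: nc_deriv_eq_vder nc_map_to_fract_vder)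
qed (simp_all add: ncps_eqI)

lemma to_fract_of_nat: "to_fract (of_nat n) = of_nat n"
  by (induction n) simp_all

instance fract :: ("{idom, ring_char_0}") ring_char_0
proof
  show "inj (of_nat :: nat \<Rightarrow> 'a fract)"
    by (simp add: inj_def flip: to_fract_of_nat)
qed


section \<open>Unordered sums of formal power series in \<open>t\<close>\<close>

text \<open>Convergence in the \<open>t\<close>-adic topology means that each coefficient of the
  partial sums is eventually constant. It is constant as soon as the finite index set contains
  \<open>B n\<close>.\<close>

lemma has_sum_fps_iff:
  fixes f :: "'i \<Rightarrow> 'a::ring_1 fps"
  assumes "\<And>n. finite (B n)" and "\<And>n. B n \<subseteq> A"
    and "\<And>n x. x \<in> A \<Longrightarrow> x \<notin> B n \<Longrightarrow> fps_nth (f x) n = 0"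
  shows "(f has_sum S) A \<longleftrightarrow> (\<forall>n. fps_nth S n = (\<Sum>x\<in>B n. fps_nth (f x) n))"
proof -
  have "(\<forall>\<^sub>F X in finite_subsets_at_top A. fps_nth (sum f X) n = fps_nth S n) \<longleftrightarrow>
      fps_nth S n = (\<Sum>x\<in>B n. fps_nth (f x) n)" for n
  proof -
    have "\<forall>\<^sub>F X in finite_subsets_at_top A. fps_nth (sum f X) n = (\<Sum>x\<in>B n. fps_nth (f x) n)"
      unfolding eventually_finite_subsets_at_top
    proof (intro exI[of _ "B n"] conjI allI impI assms(1,2))
      fix X assume "finite X \<and> B n \<subseteq> X \<and> X \<subseteq> A"
      then show "fps_nth (sum f X) n = (\<Sum>x\<in>B n. fps_nth (f x) n)"
        unfolding fps_sum_nth using assms(3) by (intro sum.mono_neutral_right) auto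
    qed
    then have "(\<forall>\<^sub>F X in finite_subsets_at_top A. fps_nth (sum f X) n = fps_nth S n) \<longleftrightarrow>
        (\<forall>\<^sub>F X in finite_subsets_at_top A. fps_nth S n = (\<Sum>x\<in>B n. fps_nth (f x) n))"
      by (intro eventually_cong) (auto elim: eventually_mono)
    then show ?thesis
      by (simp add: eventually_const)
  qed
  then show ?thesis
    by (simp add: has_sum_def tendsto_fps_iff)
qed


text \<open>Only the index \<open>m = n + 1\<close> reaches \<open>t^n\<close>; this reads the
  components of \<open>N\<close> off its expansion.\<close>

lemma fps_nth_eq_of_has_sum_powers:
  fixes a :: "nat \<Rightarrow> 'a::comm_ring_1"
  assumes "((\<lambda>m. fps_X ^ (m - 1) * fps_const (a m)) has_sum S) {1..}"
  shows "fps_nth S n = a (Suc n)"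
  using assms
  by (subst (asm) has_sum_fps_iff[of "\<lambda>n. {Suc n}"]) (auto simp: fps_X_power_mult_nth)

lemma has_sum_fps_graded:
  fixes a b :: "'i \<Rightarrow> 'a::comm_ring_1"
  assumes "\<And>n. finite {x \<in> A. d x = n}"
    and "\<And>n. fps_nth S n = (\<Sum>x\<in>{x \<in> A. d x = n}. a x * b x)"
  shows "((\<lambda>x. fps_const (a x) * fps_X ^ d x * fps_const (b x)) has_sum S) A"
proof -
  have nth: "fps_nth (fps_const (a x) * fps_X ^ d x * fps_const (b x)) n =
      (if d x = n then a x * b x else 0)" for x n
    by (auto simp: mult.assoc fps_X_power_mult_nth)
  show ?thesis
    by (subst has_sum_fps_iff[where B = "\<lambda>n. {x \<in> A. d x = n}"]) (auto simp: assms nth)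
qed


section \<open>The inverse map\<close>

lemma leaves_eq_0_iff:
  assumes "T \<in> binary_trees"
  shows "leaves T = 0 \<longleftrightarrow> T = None"
  using assms leaves_ptree_pos by (fastforce simp: binary_trees_def leaves_def)

lemma binary_trees_leaves_eq:
  assumes "1 \<le> m"
  shows "{T \<in> binary_trees. leaves T = m} = Some ` btrees m"
  using assms by (auto simp: binary_trees_def leaves_def btrees_def)

text \<open>A binary tree with \<open>m\<close> leaves has \<open>2m - 1\<close> vertices. At
  \<open>m = 0\<close> the truncated subtraction would select the empty tree, which
  \<open>1 \<le> m\<close> excludes.\<close>

lemma binary_trees_vertices_eq:
  assumes "1 \<le> m"
  shows "{T \<in> binary_trees. vertices T = 2 * m - 1} = Some ` btrees m"
proof -
  have "vertices_ptree T = 2 * m - 1 \<longleftrightarrow> leaves_ptree T = m" if "binary_ptree T" for T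
    using Suc_vertices_ptree[OF that] assms by arith
  then show ?thesis
    using assms by (auto simp: binary_trees_def vertices_def btrees_def)
qed

text \<open>Inverse tree factorials need not exist in the coefficient domain, so the identities are
  stated in its fraction field.\<close>

theorem theorem6p2:
  fixes H :: "'n::finite \<Rightarrow> ('n, 'a::{idom, ring_char_0}) ncps"
    and F G N :: "'n \<Rightarrow> ('n, 'a fps) ncps"
    and Nm :: "nat \<Rightarrow> 'n \<Rightarrow> ('n, 'a) ncps"
  assumes H_order: "2 \<le> nc_vec_order H"
    and F_def: "\<And>i. F i = nc_var i - nc_smult fps_X (nc_map fps_const (H i))"
    and G_inverse: "is_inverse_map F G"
    and G_eq: "\<And>i. G i = nc_var i + nc_smult fps_X (N i)"
    and N_expansion:
      "\<And>i. nc_has_sum (\<lambda>m. nc_smult (fps_X ^ (m - 1)) (nc_map fps_const (Nm m i))) {1..} (N i)"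
  shows "(\<forall>m\<ge>1. \<forall>i.
            nc_map to_fract (Nm m i) =
              (\<Sum>T\<in>{T \<in> binary_trees. vertices T = 2 * m - 1}.
                 nc_smult (1 / of_nat (tree_fact (prune T))) (nc_map to_fract (N_tree H T i))) \<and>
            nc_map to_fract (Nm m i) =
              (\<Sum>T\<in>{T \<in> binary_trees. leaves T = m}.
                 nc_smult (1 / of_nat (tree_fact (prune T))) (nc_map to_fract (N_tree H T i)))) \<and>
         (\<forall>i. nc_has_sum
            (\<lambda>T. nc_smult (fps_const (1 / of_nat (tree_fact (prune T))) * fps_X ^ (leaves T - 1))
                   (nc_map (\<lambda>c. fps_const (to_fract c)) (N_tree H T i)))
            (binary_trees - {None})
            (nc_map fps_to_fract (N i))) \<and>
         (\<forall>i. nc_has_sum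
            (\<lambda>T. nc_smult (fps_const (1 / of_nat (tree_fact (prune T))) * fps_X ^ leaves T)
                   (nc_map (\<lambda>c. fps_const (to_fract c)) (N_tree H T i)))
            binary_trees
            (nc_map fps_to_fract (G i)))"
proof -
  have Nm_nth: "fps_nth (ncoeff (N i) w) m = ncoeff (Nm (Suc m) i) w" for i w m
    using N_expansion[of i]
    by (auto simp: nc_has_sum_def intro: fps_nth_eq_of_has_sum_powers)
  have Nm_map: "nc_map (\<lambda>p. fps_nth p m) (N i) = Nm (Suc m) i" for m i
    by (rule ncps_eqI) (simp add: Nm_nth)
  have Nm_1: "Nm (Suc 0) i = H i" for i
    using inverse_map_at_0[OF F_def G_inverse G_eq] by (simp add: Nm_map)
  \<comment> \<open>This is the coefficient of \<open>t^m\<close> in the Burgers equation; the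
    factor \<open>Suc m\<close> comes from differentiating \<open>t^(m+1)\<close>.\<close>
  have Nm_Suc: "nc_smult (of_nat (Suc m)) (Nm (Suc (Suc m)) i) =
      (\<Sum>k=0..m. vder (Nm (Suc k)) (Nm (Suc (m - k)) i))" for m i
  proof (rule ncps_eqI)
    fix w
    have "fps_nth (ncoeff (nc_map fps_deriv (N i)) w) m = fps_nth (ncoeff (vder N (N i)) w) m"
      by (simp only: burgers_equation[OF F_def G_inverse G_eq])
    then show "ncoeff (nc_smult (of_nat (Suc m)) (Nm (Suc (Suc m)) i)) w =
        ncoeff (\<Sum>k=0..m. vder (Nm (Suc k)) (Nm (Suc (m - k)) i)) w"
      by (simp add: fps_nth_ncoeff_vder Nm_map Nm_nth)
  qed
  have Nm_btrees: "nc_map to_fract (Nm (Suc m) i) = (\<Sum>T\<in>btrees (Suc m).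
      nc_smult (1 / of_nat (tree_fact (prune_ptree T)))
        (N_ptree (\<lambda>i. nc_map to_fract (H i)) T i))" for m i
  proof (rule btrees_expansion)
    fix m i
    have "nc_smult (of_nat (Suc m)) (nc_map to_fract (Nm (Suc (Suc m)) i)) =
        nc_map to_fract (nc_smult (of_nat (Suc m)) (Nm (Suc (Suc m)) i))"
      by (rule ncps_eqI) (simp only: ncoeff_smult ncoeff_map to_fract_mult to_fract_of_nat)
    also have "\<dots> = (\<Sum>k=0..m. nc_map to_fract (vder (Nm (Suc k)) (Nm (Suc (m - k)) i)))"
      unfolding Nm_Suc by (rule ncps_eqI) simp
    finally show "nc_smult (of_nat (Suc m)) (nc_map to_fract (Nm (Suc (Suc m)) i)) =
        (\<Sum>k=0..m. vder (\<lambda>i. nc_map to_fract (Nm (Suc k) i)) (nc_map to_fract (Nm (Suc (m - k)) i)))"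
      by (simp add: nc_map_to_fract_vder)
  qed (simp add: Nm_1)
  define W :: "ptree option \<Rightarrow> 'a fract" where "W T = 1 / of_nat (tree_fact (prune T))" for T
  have expansion: "nc_map to_fract (Nm m i) =
      (\<Sum>T\<in>Some ` btrees m. nc_smult (W T) (nc_map to_fract (N_tree H T i)))" if "1 \<le> m" for m i
  proof -
    from \<open>1 \<le> m\<close> obtain n where m: "m = Suc n"
      by (cases m) auto
    show ?thesis
      unfolding m Nm_btrees
      by (simp add: sum.reindex W_def N_tree_def prune_def nc_map_to_fract_N_ptree)
  qed
  have coeff: "to_fract (fps_nth (ncoeff (N i) w) n) =
      (\<Sum>T | T \<in> binary_trees \<and> leaves T = Suc n. W T * to_fract (ncoeff (N_tree H T i) w))" for i w n
    using arg_cong[OF expansion[of "Suc n" i], of "\<lambda>f. ncoeff f w"]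
    by (simp add: Nm_nth binary_trees_leaves_eq)
  have leaves_0: "{T \<in> binary_trees. leaves T = 0} = {None}"
  proof -
    have "None \<in> binary_trees"
      by (simp add: binary_trees_def)
    then show ?thesis
      by (auto simp: leaves_eq_0_iff)
  qed
  have finite_trees: "finite {T \<in> binary_trees. leaves T = n}" for n
    by (cases n) (simp_all add: leaves_0 binary_trees_leaves_eq finite_btrees)
  show ?thesis
  proof (intro conjI allI impI)
    fix m :: nat and i
    assume m: "1 \<le> m"
    show "nc_map to_fract (Nm m i) = (\<Sum>T\<in>{T \<in> binary_trees. vertices T = 2 * m - 1}.
        nc_smult (1 / of_nat (tree_fact (prune T))) (nc_map to_fract (N_tree H T i)))"
      unfolding binary_trees_vertices_eq[OF m] W_def[symmetric] by (rule expansion[OF m])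
    show "nc_map to_fract (Nm m i) = (\<Sum>T\<in>{T \<in> binary_trees. leaves T = m}.
        nc_smult (1 / of_nat (tree_fact (prune T))) (nc_map to_fract (N_tree H T i)))"
      unfolding binary_trees_leaves_eq[OF m] W_def[symmetric] by (rule expansion[OF m])
  next
    fix i
    \<comment> \<open>With truncated subtraction the empty tree would also land in degree zero;
      removing \<open>None\<close> prevents this.\<close>
    have level: "{T \<in> binary_trees - {None}. leaves T - 1 = n} = {T \<in> binary_trees. leaves T = Suc n}" for n
    proof (rule Collect_cong)
      fix T
      show "T \<in> binary_trees - {None} \<and> leaves T - 1 = n \<longleftrightarrow> T \<in> binary_trees \<and> leaves T = Suc n"
        using leaves_eq_0_iff[of T] by (cases "leaves T") auto
    qed
    show "nc_has_sum
        (\<lambda>T. nc_smult (fps_const (1 / of_nat (tree_fact (prune T))) * fps_X ^ (leaves T - 1))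
               (nc_map (\<lambda>c. fps_const (to_fract c)) (N_tree H T i)))
        (binary_trees - {None}) (nc_map fps_to_fract (N i))"
      unfolding nc_has_sum_def W_def[symmetric] ncoeff_smult ncoeff_map
      by (intro allI has_sum_fps_graded; unfold level)
        (simp_all add: finite_trees fps_to_fract_def coeff)
    \<comment> \<open>In degree zero only the empty tree occurs, with weight \<open>1\<close>, and
      yields \<open>z_i\<close>; in higher degrees the factor \<open>t\<close> shifts the expansion
      of \<open>N\<close> by one.\<close>
    have nth_G: "to_fract (fps_nth (ncoeff (G i) w) n) =
        (\<Sum>T\<in>{T \<in> binary_trees. leaves T = n}. W T * to_fract (ncoeff (N_tree H T i) w))" for w n
    proof (cases n)
      case 0
      then show ?thesis
        by (simp add: leaves_0 W_def prune_def tree_fact_def G_eq N_tree_def ncoeff_var)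
    next
      case (Suc m)
      then show ?thesis
        by (simp add: G_eq ncoeff_var coeff)
    qed
    show "nc_has_sum
        (\<lambda>T. nc_smult (fps_const (1 / of_nat (tree_fact (prune T))) * fps_X ^ leaves T)
               (nc_map (\<lambda>c. fps_const (to_fract c)) (N_tree H T i)))
        binary_trees (nc_map fps_to_fract (G i))"
      unfolding nc_has_sum_def W_def[symmetric] ncoeff_smult ncoeff_map
      by (intro allI has_sum_fps_graded) (simp_all add: finite_trees fps_to_fract_def nth_G)
  qed
qed

end
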